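(* Let $k\ge 1$ and $n=p_1\cdots p_k$ with $p_1<\cdots<p_k$ odd primes. Then $g(\Phi_n)\ge \beta^+(n)$ and $g(\Psi_n)\ge\beta^-(n)$, where \[ \beta^{\pm}(n)=\max_{\substack{1\le r<k\\ \rho(k-r)=\mp 1}}\Bigl(\min\{p_{r+1},\,p_1\cdots p_r\}-\psi(p_1\cdots p_r)\Bigr). \] Here $\beta^+$ uses the indices $r$ with $\rho(k-r)=-1$ and $\beta^-$ those with $\rho(k-r)=+1$.
   Context: $\Phi_n(x)=\prod_{1\le j\le n,\ \gcd(j,n)=1}(x-e^{2\pi i j/n})$ is the $n$-th cyclotomic polynomial and $\Psi_n(x)=\prod_{1\le j\le n,\ \gcd(j,n)\ne1}(x-e^{2\pi i j/n})$ is the $n$-th inverse cyclotomic polynomial. For a polynomial $f=c_1x^{\nu_1}+\cdots+c_tx^{\nu_t}$ with all $c_i\ne0$ and $0\le\nu_1<\cdots<\nu_t$, the maximum gap is $g(f)=\max_{1\le i<t}(\nu_{i+1}-\nu_i)$ if $t\ne1$, and $g(f)=0$ if $t=1$. For square-free $d$, $\psi(d)=\deg\Psi_d=d-\varphi(d)$, where $\varphi$ is Euler's totient. For an integer $i$, $\rho(i)=(-1)^i$. *)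

theory Defs
  imports
    Complex_Main
    "HOL-Computational_Algebra.Polynomial"
    "HOL-Computational_Algebra.Primes"
    "HOL-Number_Theory.Totient"
begin

definition cyclotomic :: "nat \<Rightarrow> complex poly" where
  "cyclotomic n =
     (\<Prod>j\<in>{j\<in>{1..n}. gcd j n = 1}. [:- exp (2 * of_real pi * \<i> * of_nat j / of_nat n), 1:])"

definition inv_cyclotomic :: "nat \<Rightarrow> complex poly" where
  "inv_cyclotomic n =
     (\<Prod>j\<in>{j\<in>{1..n}. gcd j n \<noteq> 1}. [:- exp (2 * of_real pi * \<i> * of_nat j / of_nat n), 1:])"

definition exponents :: "'a::zero poly \<Rightarrow> nat list" where
  "exponents f = sorted_list_of_set {i. coeff f i \<noteq> 0}"

text \<open>The value for the zero polynomial, which has no exponents at all, is set to 0.\<close>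

definition max_gap :: "'a::zero poly \<Rightarrow> nat" where
  "max_gap f =
     (let \<nu> = exponents f in
      if length \<nu> \<le> 1 then 0
      else Max ((\<lambda>i. \<nu> ! Suc i - \<nu> ! i) ` {i. Suc i < length \<nu>}))"

definition psi :: "nat \<Rightarrow> nat" where
  "psi d = degree (inv_cyclotomic d)"

lemma psi_eq: "psi d = d - totient d"
proof -
  have "degree (inv_cyclotomic d) = card {j\<in>{1..d}. gcd j d \<noteq> 1}"
    unfolding inv_cyclotomic_def by (subst degree_prod_eq_sum_degree) auto
  also have "{j\<in>{1..d}. gcd j d \<noteq> 1} = {1..d} - totatives d"
    by (auto simp: totatives_def coprime_iff_gcd_eq_1)
  also have "card \<dots> = d - totient d"
    by (subst card_Diff_subset) (auto simp: totient_def totatives_def)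
  finally show ?thesis
    unfolding psi_def .
qed

text \<open>
  The primes are indexed from 1, so that the product of \<open>p\<close> over \<open>{1..r}\<close> is the product of the
  \<open>r\<close> smallest primes. The sign \<open>s\<close> is 1 or -1, and the indices that count are those for which
  \<open>(-1)\<close> to the power \<open>k - r\<close> is \<open>-s\<close>. The differences are integers and may be negative.
  For \<open>k\<close> at most 2 there may be no admissible index (\<open>s = 1\<close>, \<open>k = 1\<close> and \<open>s = -1\<close>,
  \<open>k \<le> 2\<close>); the maximum is then 0, which makes the corresponding lower bound on a gap void,
  just as the value minus infinity would.
\<close>

definition beta_indices :: "int \<Rightarrow> nat \<Rightarrow> nat set" where
  "beta_indices s k = {r. 1 \<le> r \<and> r < k \<and> (- 1) ^ (k - r) = - s}"

definition beta :: "int \<Rightarrow> (nat \<Rightarrow> nat) \<Rightarrow> nat \<Rightarrow> int" where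
  "beta s p k =
     (if beta_indices s k = {} then 0
      else Max ((\<lambda>r. int (min (p (r + 1)) (\<Prod>i\<in>{1..r}. p i)) - int (psi (\<Prod>i\<in>{1..r}. p i)))
                ` beta_indices s k))"

abbreviation beta_plus :: "(nat \<Rightarrow> nat) \<Rightarrow> nat \<Rightarrow> int" where
  "beta_plus \<equiv> beta 1"

abbreviation beta_minus :: "(nat \<Rightarrow> nat) \<Rightarrow> nat \<Rightarrow> int" where
  "beta_minus \<equiv> beta (- 1)"

end

theory Submission
  imports
    Defs
    "HOL-Number_Theory.Cong"
    "HOL-Analysis.Complex_Transcendental"
begin

text \<open>
  Let \<open>d\<close> be the product of the \<open>r\<close> smallest primes. Since \<open>\<Phi>\<^bsub>eq\<^esub>(x) \<Phi>\<^bsub>e\<^esub>(x) = \<Phi>\<^bsub>e\<^esub>(x\<^sup>q)\<close> for a prime \<open>q\<close> not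
  dividing \<open>e\<close>, multiplying the index by a prime \<open>q \<ge> p\<^bsub>r+1\<^esub>\<close> inverts the cyclotomic polynomial
  modulo \<open>x\<^bsup>p(r+1)\<^esup>\<close>. Hence \<open>\<Phi>\<^bsub>n\<^esub>\<close> is congruent to \<open>\<Phi>\<^bsub>d\<^esub>\<close> or to its inverse according to the parity of
  \<open>k - r\<close>. Because \<open>\<Phi>\<^bsub>d\<^esub> \<Psi>\<^bsub>d\<^esub> = x\<^sup>d - 1\<close>, in the odd case \<open>\<Phi>\<^bsub>n\<^esub>\<close>, and in the even case \<open>\<Psi>\<^bsub>n\<^esub>\<close>, agrees up to
  sign with \<open>\<Psi>\<^bsub>d\<^esub>\<close> modulo \<open>x\<close> to the power \<open>min {p\<^bsub>r+1\<^esub>, d}\<close>. As \<open>\<Psi>\<^bsub>d\<^esub>\<close> has degree \<open>\<psi>(d)\<close>, the exponent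
  following \<open>\<psi>(d)\<close> is at least \<open>min {p\<^bsub>r+1\<^esub>, d}\<close>.
\<close>

section \<open>Gaps from blocks of vanishing coefficients\<close>

text \<open>Since \<open>a\<close> lies below the degree, it has a successor among the exponents,
  and the vanishing block pushes this successor up to \<open>b\<close> or beyond.\<close>

lemma max_gap_ge:
  fixes f :: "'a::zero poly"
  assumes "coeff f a \<noteq> 0" and "a < degree f"
    and gap: "\<And>i. a < i \<Longrightarrow> i < b \<Longrightarrow> coeff f i = 0"
  shows "b - a \<le> max_gap f"
proof -
  define \<nu> where "\<nu> = exponents f"
  have "{i. coeff f i \<noteq> 0} \<subseteq> {..degree f}"
    by (auto simp: le_degree)
  then have fin: "finite {i. coeff f i \<noteq> 0}"
    by (rule finite_subset) simp
  have set_\<nu>: "set \<nu> = {i. coeff f i \<noteq> 0}"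
    using fin by (simp add: \<nu>_def exponents_def)
  have sorted: "sorted_wrt (<) \<nu>"
    by (simp add: \<nu>_def exponents_def)
  from assms(1) set_\<nu> obtain i where i: "i < length \<nu>" "\<nu> ! i = a"
    by (auto simp: in_set_conv_nth set_eq_iff)
  from assms(2) have "degree f \<in> set \<nu>"
    using set_\<nu> leading_coeff_0_iff by fastforce
  then obtain j where j: "j < length \<nu>" "\<nu> ! j = degree f"
    by (auto simp: in_set_conv_nth)
  have "i < j"
  proof (rule ccontr)
    assume "\<not> i < j"
    then have "\<nu> ! j \<le> \<nu> ! i"
      using sorted i(1) by (cases "i = j") (auto simp: sorted_wrt_iff_nth_less less_imp_le)
    with i j assms(2) show False by simp
  qed
  with j have Suc_i: "Suc i < length \<nu>" by simp
  then have "\<nu> ! Suc i \<in> set \<nu>" by simp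
  then have "coeff f (\<nu> ! Suc i) \<noteq> 0" using set_\<nu> by auto
  moreover have "a < \<nu> ! Suc i"
    using sorted Suc_i i(2) by (auto simp: sorted_wrt_iff_nth_less)
  ultimately have "b \<le> \<nu> ! Suc i"
    using gap leI by blast
  then have "b - a \<le> \<nu> ! Suc i - \<nu> ! i"
    using i(2) by simp
  also have "\<dots> \<le> Max ((\<lambda>i. \<nu> ! Suc i - \<nu> ! i) ` {i. Suc i < length \<nu>})"
  proof (rule Max_ge)
    have "{i. Suc i < length \<nu>} \<subseteq> {..<length \<nu>}" by auto
    then show "finite ((\<lambda>i. \<nu> ! Suc i - \<nu> ! i) ` {i. Suc i < length \<nu>})"
      using finite_subset by blast
  qed (use Suc_i in auto)
  also have "\<dots> = max_gap f"
    using Suc_i by (simp add: max_gap_def \<nu>_def Let_def)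
  finally show ?thesis .
qed

section \<open>Cyclotomic polynomials as products over roots of unity\<close>

lemma lead_coeff_prod_linear:
  fixes f :: "'b \<Rightarrow> 'a::idom"
  shows "lead_coeff (\<Prod>a\<in>A. [:- f a, 1:]) = 1"
  by (simp add: lead_coeff_prod)

lemma degree_prod_linear:
  fixes f :: "'b \<Rightarrow> 'a::idom"
  shows "degree (\<Prod>a\<in>A. [:- f a, 1:]) = card A"
  by (subst degree_prod_eq_sum_degree) auto

text \<open>Two monic polynomials of degree \<open>card A\<close> that agree at
  \<open>card A\<close> distinct points are equal, as their difference has smaller degree.\<close>

lemma monic_eq_prod_roots:
  fixes P :: "'a::idom poly"
  assumes "finite A" and "inj_on f A" and "lead_coeff P = 1" and "degree P = card A"
    and "\<And>a. a \<in> A \<Longrightarrow> poly P (f a) = 0"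
  shows "P = (\<Prod>a\<in>A. [:- f a, 1:])"
proof (rule poly_eqI_degree_lead_coeff[where n = "card A" and A = "f ` A"])
  show "coeff P (card A) = coeff (\<Prod>a\<in>A. [:- f a, 1:]) (card A)"
    using assms(3,4) lead_coeff_prod_linear[of f A] by (simp add: degree_prod_linear)
  show "poly P z = poly (\<Prod>a\<in>A. [:- f a, 1:]) z" if "z \<in> f ` A" for z
    using that assms(1,5) by (auto simp: poly_prod)
qed (use assms in \<open>auto simp: card_image degree_prod_linear\<close>)

abbreviation unity_root :: "nat \<Rightarrow> nat \<Rightarrow> complex" where
  "unity_root n j \<equiv> exp (2 * of_real pi * \<i> * of_nat j / of_nat n)"

lemma inj_on_unity_root: "inj_on (unity_root n) {1..n}"
proof (rule inj_onI)
  fix i j assume *: "i \<in> {1..n}" "j \<in> {1..n}" "unity_root n i = unity_root n j"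
  then have "i mod n = j mod n"
    using complex_root_unity_eq[of n i j] by simp
  with * show "i = j"
    by (cases "i = n"; cases "j = n") auto
qed

lemma cyclotomic_coprime:
  "cyclotomic n = (\<Prod>j\<in>{j \<in> {1..n}. coprime j n}. [:- unity_root n j, 1:])"
  by (simp add: cyclotomic_def coprime_iff_gcd_eq_1)

lemma inv_cyclotomic_not_coprime:
  "inv_cyclotomic n = (\<Prod>j\<in>{j \<in> {1..n}. \<not> coprime j n}. [:- unity_root n j, 1:])"
  by (simp add: inv_cyclotomic_def coprime_iff_gcd_eq_1)

lemma lead_coeff_cyclotomic: "lead_coeff (cyclotomic n) = 1"
  unfolding cyclotomic_coprime by (rule lead_coeff_prod_linear)

lemma lead_coeff_inv_cyclotomic: "lead_coeff (inv_cyclotomic n) = 1"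
  unfolding inv_cyclotomic_not_coprime by (rule lead_coeff_prod_linear)

lemma degree_cyclotomic: "degree (cyclotomic n) = totient n"
proof -
  have "{j \<in> {1..n}. coprime j n} = totatives n"
    by (auto simp: totatives_def)
  then show ?thesis
    by (simp add: cyclotomic_coprime degree_prod_linear totient_def)
qed

text \<open>The index \<open>a\<close> may exceed \<open>n\<close>, as happens for the roots of
  order dividing \<open>e * q\<close> after taking their \<open>q\<close>-th power.\<close>

lemma poly_cyclotomic_unity_root:
  assumes "n > 0" and "coprime a n"
  shows "poly (cyclotomic n) (unity_root n a) = 0"
proof -
  \<comment> \<open>The representative must lie in \<open>{1..n}\<close>; for \<open>n = 1\<close>
    the residue would be 0.\<close>
  define b where "b = (if n = 1 then 1 else a mod n)"
  have "b \<in> {j \<in> {1..n}. coprime j n}"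
  proof (cases "n = 1")
    case False
    have "coprime (a mod n) n"
      using assms by (simp add: coprime_mod_left_iff)
    moreover from this False have "a mod n \<noteq> 0"
      by (metis coprime_0_left_iff nat_dvd_1_iff_1)
    ultimately show ?thesis
      using False assms(1) by (simp add: b_def less_imp_le)
  qed (simp add: b_def)
  moreover have "unity_root n a = unity_root n b"
    using assms(1) by (subst complex_root_unity_eq) (auto simp: b_def)
  ultimately show ?thesis
    unfolding cyclotomic_coprime poly_prod by (intro prod_zero) auto
qed

lemma poly_cyclotomic_0_nonzero: "poly (cyclotomic n) 0 \<noteq> 0"
  by (simp add: cyclotomic_coprime poly_prod)

lemma cyclotomic_mult_inv_cyclotomic:
  assumes "n > 0"
  shows "cyclotomic n * inv_cyclotomic n = monom 1 n - 1"
proof -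
  have deg: "degree (monom 1 n - 1 :: complex poly) = n"
    using assms degree_add_eq_left[of "- 1" "monom (1 :: complex) n"] by (simp add: degree_monom_eq)
  have "monom 1 n - 1 = (\<Prod>j\<in>{1..n}. [:- unity_root n j, 1:])"
  proof (rule monic_eq_prod_roots[OF _ inj_on_unity_root])
    show "lead_coeff (monom 1 n - 1 :: complex poly) = 1"
      using assms by (simp add: deg)
    show "poly (monom 1 n - 1) (unity_root n j) = 0" for j
      using complex_root_unity[of n j] assms by (simp add: poly_monom)
  qed (simp_all add: deg)
  also have "{1..n} = {j \<in> {1..n}. coprime j n} \<union> {j \<in> {1..n}. \<not> coprime j n}"
    by auto
  also have "(\<Prod>j\<in>\<dots>. [:- unity_root n j, 1:]) = cyclotomic n * inv_cyclotomic n"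
    unfolding cyclotomic_coprime inv_cyclotomic_not_coprime by (rule prod.union_disjoint) auto
  finally show ?thesis by simp
qed

text \<open>
  Both sides are monic with simple roots \<open>unity_root (e * q) a\<close>, where \<open>a \<le> e * q\<close> is coprime to \<open>e\<close>;
  those with \<open>q\<close> dividing \<open>a\<close> are the roots of the factor \<open>cyclotomic e\<close>.
\<close>

lemma cyclotomic_mult_prime:
  assumes "prime q" and "\<not> q dvd e" and "e > 0"
  shows "cyclotomic (e * q) * cyclotomic e = pcompose (cyclotomic e) (monom 1 q)"
proof -
  have "q > 0" using assms(1) by (rule prime_gt_0_nat)
  define A where "A = {a \<in> {1..e * q}. coprime a (e * q)}"
  define B where "B = {b \<in> {1..e}. coprime b e}"
  have cop: "coprime e q"
    using assms(1,2) by (metis coprime_commute prime_imp_coprime)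
  have mult_root: "unity_root (e * q) (b * q) = unity_root e b" for b
    using \<open>q > 0\<close> by (simp add: mult.assoc)
  have inj: "inj_on (\<lambda>b. b * q) B"
    using \<open>q > 0\<close> by (auto intro: inj_onI)
  have disj: "A \<inter> (\<lambda>b. b * q) ` B = {}"
    using assms(1) by (auto simp: A_def)
  have prod_eq: "cyclotomic (e * q) * cyclotomic e
      = (\<Prod>a\<in>A \<union> (\<lambda>b. b * q) ` B. [:- unity_root (e * q) a, 1:])"
  proof -
    have "cyclotomic e = (\<Prod>b\<in>B. [:- unity_root (e * q) (b * q), 1:])"
      unfolding mult_root by (simp add: cyclotomic_coprime B_def)
    also have "\<dots> = (\<Prod>a\<in>(\<lambda>b. b * q) ` B. [:- unity_root (e * q) a, 1:])"
      using inj by (subst prod.reindex) simp_all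
    finally show ?thesis
      using disj by (subst prod.union_disjoint) (simp_all add: cyclotomic_coprime A_def B_def)
  qed
  have deg: "degree (pcompose (cyclotomic e) (monom 1 q)) = totient e * q"
    by (simp add: degree_pcompose degree_monom_eq degree_cyclotomic)
  have "totient (e * q) + totient e = totient e * q"
    using assms(1) \<open>q > 0\<close> cop by (simp add: totient_mult_coprime totient_prime algebra_simps flip: mult_Suc_right)
  \<comment> \<open>The cardinality is read off from the degrees in \<open>prod_eq\<close>.\<close>
  then have card: "card (A \<union> (\<lambda>b. b * q) ` B) = totient e * q"
    by (metis prod_eq degree_prod_linear degree_mult_eq degree_cyclotomic
        leading_coeff_0_iff lead_coeff_cyclotomic zero_neq_one)
  have "pcompose (cyclotomic e) (monom 1 q)
      = (\<Prod>a\<in>A \<union> (\<lambda>b. b * q) ` B. [:- unity_root (e * q) a, 1:])"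
  proof (rule monic_eq_prod_roots)
    have "A \<union> (\<lambda>b. b * q) ` B \<subseteq> {1..e * q}"
      using \<open>q > 0\<close> by (auto simp: A_def B_def)
    then show "inj_on (unity_root (e * q)) (A \<union> (\<lambda>b. b * q) ` B)"
      by (rule inj_on_subset[OF inj_on_unity_root])
    show "lead_coeff (pcompose (cyclotomic e) (monom 1 q)) = 1"
      using \<open>q > 0\<close> by (subst lead_coeff_comp) (simp_all add: degree_monom_eq lead_coeff_cyclotomic)
    show "poly (pcompose (cyclotomic e) (monom 1 q)) (unity_root (e * q) a) = 0"
      if "a \<in> A \<union> (\<lambda>b. b * q) ` B" for a
    proof -
      have "coprime a e"
        using that cop by (auto simp: A_def B_def)
          (simp add: coprime_commute)
      moreover have "unity_root (e * q) a ^ q = unity_root e a"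
        using \<open>q > 0\<close> by (simp flip: exp_of_nat_mult)
      ultimately show ?thesis
        using assms(3) by (simp add: poly_pcompose poly_monom poly_cyclotomic_unity_root)
    qed
    show "finite (A \<union> (\<lambda>b. b * q) ` B)"
      by (simp add: A_def B_def)
  qed (simp only: deg card)
  with prod_eq show ?thesis by simp
qed

text \<open>At 0 the identity for \<open>cyclotomic (e * q)\<close> has the same nonzero factor
  \<open>poly (cyclotomic e) 0\<close> on both sides.\<close>

lemma poly_cyclotomic_mult_prime_0:
  assumes "prime q" and "\<not> q dvd e" and "e > 0"
  shows "poly (cyclotomic (e * q)) 0 = 1"
proof -
  have "poly (cyclotomic (e * q)) 0 * poly (cyclotomic e) 0 = poly (cyclotomic e) 0"
    using arg_cong[OF cyclotomic_mult_prime[OF assms], of "\<lambda>f. poly f 0"] assms(1)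
    by (simp add: poly_pcompose poly_monom prime_gt_0_nat zero_power)
  then show ?thesis
    using poly_cyclotomic_0_nonzero[of e] by simp
qed

section \<open>Congruences modulo powers of x\<close>

lemma cong_monom_iff:
  fixes f g :: "'a::field poly"
  shows "[f = g] (mod monom 1 m) \<longleftrightarrow> (\<forall>i<m. coeff f i = coeff g i)"
  by (simp add: cong_iff_dvd_diff monom_1_dvd_iff')

lemma cong_monom_le:
  fixes f g :: "'a::field poly"
  assumes "[f = g] (mod monom 1 m)" and "l \<le> m"
  shows "[f = g] (mod monom 1 l)"
  using assms by (simp add: cong_monom_iff)

text \<open>Substituting x^q into a polynomial with constant term 1 leaves 1 plus a multiple of
  x^q.\<close>

lemma cong_cyclotomic_mult_prime:
  assumes "prime q" and "\<not> q dvd e" and "e > 0" and "poly (cyclotomic e) 0 = 1"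
  shows "[cyclotomic (e * q) * cyclotomic e = 1] (mod monom 1 q)"
proof -
  obtain a g where ag: "cyclotomic e = pCons a g" by (cases "cyclotomic e")
  with assms(4) have "a = 1" by simp
  with ag have "pcompose (cyclotomic e) (monom 1 q) = 1 + monom 1 q * pcompose g (monom 1 q)"
    by (simp add: pcompose_pCons one_pCons)
  then show ?thesis
    unfolding cyclotomic_mult_prime[OF assms(1-3)] by (simp add: cong_iff_dvd_diff)
qed

lemma cong_inv_cyclotomic:
  assumes "n > 0" and "m \<le> n"
  shows "[cyclotomic n * inv_cyclotomic n = - 1] (mod monom 1 m)"
  using assms by (simp add: cyclotomic_mult_inv_cyclotomic cong_monom_iff)

text \<open>Below \<open>m\<close> the last nonzero coefficient of \<open>f\<close> comes from the
  leading coefficient of \<open>inv_cyclotomic d\<close>; the degree condition makes another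
  exponent follow.\<close>

lemma max_gap_ge_psi:
  assumes "c \<noteq> 0" and "[f = smult c (inv_cyclotomic d)] (mod monom 1 m)"
    and "psi d < m" and "psi d < degree f"
  shows "int m - int (psi d) \<le> int (max_gap f)"
proof -
  have eq: "coeff f i = c * coeff (inv_cyclotomic d) i" if "i < m" for i
    using assms(2) that by (simp add: cong_monom_iff)
  have "m - psi d \<le> max_gap f"
  proof (rule max_gap_ge)
    show "coeff f (psi d) \<noteq> 0"
      using assms(1,3) lead_coeff_inv_cyclotomic[of d] by (simp add: eq psi_def)
    show "coeff f i = 0" if "psi d < i" "i < m" for i
      using that by (simp add: eq psi_def coeff_eq_0)
  qed fact
  then show ?thesis by linarith
qed

text \<open>\<open>psi\<close> counts the non-coprime residues; those for \<open>d\<close> persist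
  for \<open>d * m\<close>, and \<open>d * m\<close> itself is new.\<close>

lemma psi_less_psi_mult:
  assumes "d > 0" and "m > 1"
  shows "psi d < psi (d * m)"
proof -
  have psi_card: "psi l = card {j \<in> {1..l}. \<not> coprime j l}" for l
    unfolding psi_def inv_cyclotomic_not_coprime by (rule degree_prod_linear)
  have "{j \<in> {1..d}. \<not> coprime j d} \<subset> {j \<in> {1..d * m}. \<not> coprime j (d * m)}"
  proof
    show "{j \<in> {1..d}. \<not> coprime j d} \<subseteq> {j \<in> {1..d * m}. \<not> coprime j (d * m)}"
      using assms by (auto intro: order_trans)
    have "d * m \<in> {j \<in> {1..d * m}. \<not> coprime j (d * m)} - {j \<in> {1..d}. \<not> coprime j d}"
      using assms by auto
    then show "{j \<in> {1..d}. \<not> coprime j d} \<noteq> {j \<in> {1..d * m}. \<not> coprime j (d * m)}"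
      by blast
  qed
  then show ?thesis
    unfolding psi_card by (intro psubset_card_mono) auto
qed

section \<open>Products of the smallest primes\<close>

context
  fixes k :: nat and p :: "nat \<Rightarrow> nat"
  assumes p: "\<And>i. i \<in> {1..k} \<Longrightarrow> prime (p i) \<and> odd (p i)"
    and mono: "strict_mono_on {1..k} p"
begin

abbreviation (input) P :: "nat \<Rightarrow> nat" where
  "P r \<equiv> \<Prod>i\<in>{1..r}. p i"

lemma P_pos: "r \<le> k \<Longrightarrow> P r > 0"
  using p by (auto intro!: prod_pos prime_gt_0_nat)

lemma P_Suc: "P (Suc r) = P r * p (Suc r)"
  by simp

lemma not_dvd_P:
  assumes "r < i" and "i \<le> k"
  shows "\<not> p i dvd P r"
proof
  assume "p i dvd P r"
  moreover have "prime (p i)" using p assms by simp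
  ultimately obtain j where j: "j \<in> {1..r}" "p i dvd p j"
    by (auto simp: prime_dvd_prod_iff)
  then have "p i = p j"
    using p assms by (auto intro: primes_dvd_imp_eq)
  moreover have "p j < p i"
    using mono j(1) assms by (auto simp: strict_mono_on_def)
  ultimately show False by simp
qed

text \<open>The last prime is split off, with the empty product 1 left over if \<open>r = 1\<close>.
  Index 1 itself is excluded, since \<open>cyclotomic 1\<close> is x - 1, with value -1 at
  0.\<close>

lemma cyclotomic_P_0:
  assumes "1 \<le> r" and "r \<le> k"
  shows "poly (cyclotomic (P r)) 0 = 1"
proof -
  obtain s where s: "r = Suc s" using assms(1) by (cases r) auto
  show ?thesis
    unfolding s P_Suc using assms p not_dvd_P P_pos
    by (intro poly_cyclotomic_mult_prime_0) (auto simp: s)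
qed

lemma cong_cyclotomic_P:
  assumes "1 \<le> r" and "r < k" and "r \<le> s" and "s \<le> k"
  shows "if even (s - r) then [cyclotomic (P s) = cyclotomic (P r)] (mod monom 1 (p (r + 1)))
    else [cyclotomic (P s) * cyclotomic (P r) = 1] (mod monom 1 (p (r + 1)))"
  using assms(3,4)
proof (induction s rule: dec_induct)
  case base
  then show ?case by simp
next
  case (step s)
  let ?X = "monom 1 (p (r + 1)) :: complex poly"
  \<comment> \<open>The new prime inverts modulo its own power of x, hence modulo the smaller power
    fixed by \<open>r\<close>.\<close>
  have "p (r + 1) \<le> p (Suc s)"
    using mono step.hyps step.prems by (cases "r = s") (auto simp: strict_mono_on_def less_imp_le)
  moreover have "[cyclotomic (P s * p (Suc s)) * cyclotomic (P s) = 1] (mod monom 1 (p (Suc s)))"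
    using p step assms cyclotomic_P_0 not_dvd_P P_pos
    by (intro cong_cyclotomic_mult_prime) auto
  ultimately have 1: "[cyclotomic (P (Suc s)) * cyclotomic (P s) = 1] (mod ?X)"
    unfolding P_Suc using cong_monom_le by blast
  show ?case
  proof (cases "even (s - r)")
    case True
    then have 2: "[cyclotomic (P s) = cyclotomic (P r)] (mod ?X)"
      using step by simp
    have "[cyclotomic (P (Suc s)) * cyclotomic (P r) = 1] (mod ?X)"
      by (rule cong_trans[OF cong_scalar_left[OF cong_sym[OF 2]] 1])
    with True step.hyps show ?thesis by (simp add: Suc_diff_le)
  next
    case False
    then have 2: "[cyclotomic (P s) * cyclotomic (P r) = 1] (mod ?X)"
      using step by simp
    have "[cyclotomic (P (Suc s)) = cyclotomic (P (Suc s)) * (cyclotomic (P s) * cyclotomic (P r))] (mod ?X)"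
      using cong_scalar_left[OF cong_sym[OF 2], of "cyclotomic (P (Suc s))"] by simp
    also have "[cyclotomic (P (Suc s)) * (cyclotomic (P s) * cyclotomic (P r)) = cyclotomic (P r)] (mod ?X)"
      using cong_scalar_right[OF 1, of "cyclotomic (P r)"] by (simp add: mult.assoc)
    finally show ?thesis using False step.hyps by (simp add: Suc_diff_le)
  qed
qed

section \<open>Gap bounds for a single index\<close>

lemma P_split:
  assumes "r \<le> k"
  shows "P k = P r * (\<Prod>i\<in>{r+1..k}. p i)"
proof -
  have "prod p {1..r + (k - r)} = P r * prod p {r+1..r + (k - r)}"
    by (rule prod.ub_add_nat) simp
  with assms show ?thesis by simp
qed

text \<open>If \<open>psi (P r)\<close> reaches the minimum, the left-hand side is at most 0; only
  the other case needs the congruences.\<close>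

lemma max_gap_cyclotomic_ge:
  assumes "1 \<le> r" and "r < k" and odd: "odd (k - r)"
  shows "int (min (p (r + 1)) (P r)) - int (psi (P r)) \<le> int (max_gap (cyclotomic (P k)))"
proof (cases "psi (P r) < min (p (r + 1)) (P r)")
  case True
  define m where "m = min (p (r + 1)) (P r)"
  let ?X = "monom 1 m :: complex poly"
  have 1: "[cyclotomic (P k) * cyclotomic (P r) = 1] (mod ?X)"
    using cong_cyclotomic_P[of r k] assms by (auto simp: m_def intro: cong_monom_le)
  have 2: "[cyclotomic (P r) * inv_cyclotomic (P r) = - 1] (mod ?X)"
    using P_pos[of r] assms by (intro cong_inv_cyclotomic) (auto simp: m_def)
  have "[- cyclotomic (P k) = cyclotomic (P k) * cyclotomic (P r) * inv_cyclotomic (P r)] (mod ?X)"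
    using cong_scalar_left[OF cong_sym[OF 2], of "cyclotomic (P k)"] by (simp add: mult.assoc)
  also have "[cyclotomic (P k) * cyclotomic (P r) * inv_cyclotomic (P r) = inv_cyclotomic (P r)] (mod ?X)"
    using cong_scalar_right[OF 1, of "inv_cyclotomic (P r)"] by simp
  finally have *: "[cyclotomic (P k) = smult (- 1) (inv_cyclotomic (P r))] (mod ?X)"
    using cong_minus_minus_iff by fastforce
  \<comment> \<open>This puts \<open>psi (P r)\<close> below the degree of
    \<open>cyclotomic (P k)\<close>, so that the gap is closed by a later exponent.\<close>
  have "psi (P r) < totient (P k)"
  proof -
    define q where "q = p (r + 1)"
    define t where "t = (\<Prod>i\<in>{r+1..k}. p i)"
    have q: "prime q" using p assms by (simp add: q_def)
    have "q dvd t" unfolding q_def t_def using assms by (intro dvd_prodI) auto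
    have "t > 0" unfolding t_def using p by (auto intro!: prod_pos prime_gt_0_nat)
    have "coprime (P r) t"
      unfolding t_def using p not_dvd_P[of r] assms
      by (intro prod_coprime_right) (metis atLeastAtMost_iff coprime_commute prime_imp_coprime
          Suc_eq_plus1 Suc_le_lessD le_trans le_add2)
    then have eq: "totient (P k) = totient (P r) * totient t"
      using P_split[of r] assms by (simp add: t_def totient_mult_coprime)
    have "psi (P r) < q" using True by (simp add: q_def)
    then have "psi (P r) \<le> q - 1" by simp
    also have "\<dots> = totient q" using q by (simp add: totient_prime)
    also have "\<dots> \<le> totient t"
      using \<open>q dvd t\<close> \<open>t > 0\<close> by (intro totient_dvd_mono)
    \<comment> \<open>Strictness comes from \<open>P r > 2\<close>, where oddness rules out
      \<open>p 1 = 2\<close>.\<close>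
    also have "\<dots> < totient (P r) * totient t"
    proof -
      have "p 1 dvd P r" using assms by (intro dvd_prodI) auto
      then have "p 1 \<le> P r" using P_pos[of r] assms by (intro dvd_imp_le) auto
      moreover have "p 1 > 2"
        using p[of 1] assms prime_ge_2_nat[of "p 1"] by (cases "p 1 = 2") auto
      ultimately have "totient (P r) > 1" by (intro totient_gt_1) simp
      then show ?thesis using \<open>t > 0\<close> by simp
    qed
    finally show ?thesis using eq by simp
  qed
  then show ?thesis
    using max_gap_ge_psi[OF _ *] True by (simp add: degree_cyclotomic m_def)
qed linarith

lemma max_gap_inv_cyclotomic_ge:
  assumes "1 \<le> r" and "r < k" and even: "even (k - r)"
  shows "int (min (p (r + 1)) (P r)) - int (psi (P r)) \<le> int (max_gap (inv_cyclotomic (P k)))"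
proof (cases "psi (P r) < min (p (r + 1)) (P r)")
  case True
  define m where "m = min (p (r + 1)) (P r)"
  let ?X = "monom 1 m :: complex poly"
  define t where "t = (\<Prod>i\<in>{r+1..k}. p i)"
  have Pk: "P k = P r * t"
    using P_split[of r] assms by (simp add: t_def)
  have "p k dvd t" unfolding t_def using assms by (intro dvd_prodI) auto
  moreover have "t > 0" unfolding t_def using p by (auto intro!: prod_pos prime_gt_0_nat)
  ultimately have "p k \<le> t" by (intro dvd_imp_le)
  with p[of k] have t: "t > 1" using assms prime_gt_1_nat[of "p k"] by simp
  have "P r \<le> P k" using Pk \<open>t > 0\<close> by simp
  then have "m \<le> P k" by (simp add: m_def)
  have 1: "[cyclotomic (P k) = cyclotomic (P r)] (mod ?X)"
    using cong_cyclotomic_P[of r k] assms by (auto simp: m_def intro: cong_monom_le)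
  have 2: "[cyclotomic (P r) * inv_cyclotomic (P r) = - 1] (mod ?X)"
    using P_pos[of r] assms by (intro cong_inv_cyclotomic) (auto simp: m_def)
  have 3: "[cyclotomic (P k) * inv_cyclotomic (P k) = - 1] (mod ?X)"
    using P_pos[of k] \<open>m \<le> P k\<close> by (intro cong_inv_cyclotomic) auto
  \<comment> \<open>One triple product is evaluated twice: \<open>cyclotomic (P r)\<close> cancels
    first against \<open>inv_cyclotomic (P r)\<close>, then, replaced by
    \<open>cyclotomic (P k)\<close>, against \<open>inv_cyclotomic (P k)\<close>.\<close>
  have "[- inv_cyclotomic (P k) = cyclotomic (P r) * inv_cyclotomic (P r) * inv_cyclotomic (P k)] (mod ?X)"
    using cong_scalar_right[OF cong_sym[OF 2], of "inv_cyclotomic (P k)"] by simp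
  also have "[cyclotomic (P r) * inv_cyclotomic (P r) * inv_cyclotomic (P k)
      = inv_cyclotomic (P r) * (cyclotomic (P k) * inv_cyclotomic (P k))] (mod ?X)"
    using cong_scalar_right[OF cong_sym[OF 1], of "inv_cyclotomic (P r) * inv_cyclotomic (P k)"]
    by (simp add: mult_ac)
  also have "[inv_cyclotomic (P r) * (cyclotomic (P k) * inv_cyclotomic (P k))
      = - inv_cyclotomic (P r)] (mod ?X)"
    using cong_scalar_left[OF 3, of "inv_cyclotomic (P r)"] by simp
  finally have *: "[inv_cyclotomic (P k) = smult 1 (inv_cyclotomic (P r))] (mod ?X)"
    by (simp add: cong_minus_minus_iff)
  have "psi (P r) < degree (inv_cyclotomic (P k))"
    unfolding Pk psi_def[symmetric] using P_pos[of r] assms t by (intro psi_less_psi_mult) auto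
  then show ?thesis
    using max_gap_ge_psi[OF _ *] True by (simp add: m_def)
qed linarith

end

section \<open>The maximum over all admissible indices\<close>

text \<open>Without admissible indices \<open>beta\<close> is 0, and the bound holds because
  \<open>g\<close> is a natural number.\<close>

lemma beta_le:
  assumes "\<And>r. r \<in> beta_indices s k \<Longrightarrow>
    int (min (p (r + 1)) (\<Prod>i\<in>{1..r}. p i)) - int (psi (\<Prod>i\<in>{1..r}. p i)) \<le> int g"
  shows "beta s p k \<le> int g"
proof -
  have "beta_indices s k \<subseteq> {..<k}"
    by (auto simp: beta_indices_def)
  then have "finite (beta_indices s k)"
    by (rule finite_subset) simp
  with assms show ?thesis
    by (auto simp: beta_def)
qed

theorem theorem2:
  fixes k n :: nat and p :: "nat \<Rightarrow> nat"
  assumes "k \<ge> 1"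
    and "\<And>i. i \<in> {1..k} \<Longrightarrow> prime (p i) \<and> odd (p i)"
    and "strict_mono_on {1..k} p"
    and "n = (\<Prod>i\<in>{1..k}. p i)"
  shows "int (max_gap (cyclotomic n)) \<ge> beta_plus p k \<and>
         int (max_gap (inv_cyclotomic n)) \<ge> beta_minus p k"
proof
  show "int (max_gap (cyclotomic n)) \<ge> beta_plus p k"
    unfolding assms(4)
  proof (rule beta_le, rule max_gap_cyclotomic_ge[OF assms(2,3)])
    fix r assume r: "r \<in> beta_indices 1 k"
    then show "1 \<le> r" "r < k" by (simp_all add: beta_indices_def)
    show "odd (k - r)"
      using r by (cases "even (k - r)") (auto simp: beta_indices_def)
  qed
  show "int (max_gap (inv_cyclotomic n)) \<ge> beta_minus p k"
    unfolding assms(4)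
  proof (rule beta_le, rule max_gap_inv_cyclotomic_ge[OF assms(2,3)])
    fix r assume r: "r \<in> beta_indices (- 1) k"
    then show "1 \<le> r" "r < k" by (simp_all add: beta_indices_def)
    show "even (k - r)"
      using r by (cases "even (k - r)") (auto simp: beta_indices_def)
  qed
qed

end
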